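(* Let $\mathsf{M}_2$ be the space of $2\times 2$ complex matrices and $\mathsf{M}_2^+$ the cone of positive semidefinite matrices in it. Then $\gamma(\mathsf{M}_2^+) = 4$ and $\gamma^{\mathrm{cp}}(\mathsf{M}_2^+) = 3$.
   Context: Regard $\mathsf{M}_2^+$ as a proper cone in the real vector space of $2\times 2$ Hermitian matrices (linear maps $\Phi$ on $\mathsf{M}_2$ preserving Hermiticity act on it). A linear map $\Phi$ is $\mathsf{M}_2^+$-positive if $\Phi(\mathsf{M}_2^+) \subset \mathsf{M}_2^+$, strictly $\mathsf{M}_2^+$-positive if it maps $\mathsf{M}_2^+\setminus\{0\}$ into the interior of $\mathsf{M}_2^+$ (the positive definite matrices), and $\mathsf{M}_2^+$-primitive if it is $\mathsf{M}_2^+$-positive and some power $\Phi^k$ ($k \geq 1$) is strictly $\mathsf{M}_2^+$-positive; $\gamma(\mathsf{M}_2^+,\Phi)$ is the smallest such $k$. The maximal exponent $\gamma(\mathsf{M}_2^+)$ is the supremum of $\gamma(\mathsf{M}_2^+,\Phi)$ over all $\mathsf{M}_2^+$-primitive linear maps $\Phi$, and $\gamma^{\mathrm{cp}}(\mathsf{M}_2^+)$ is the supremum of $\gamma(\mathsf{M}_2^+,\Phi)$ over all linear maps $\Phi : \mathsf{M}_2 \to \mathsf{M}_2$ that are completely positive and $\mathsf{M}_2^+$-primitive. *)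

theory Defs
  imports "HOL-Analysis.Analysis" "HOL-Library.Extended_Nat"
begin

definition cinner2 :: "complex^2 \<Rightarrow> complex^2 \<Rightarrow> complex" where
  "cinner2 x y = (\<Sum>i\<in>UNIV. cnj (x$i) * y$i)"

definition cadj :: "complex^2^2 \<Rightarrow> complex^2^2" where
  "cadj A = (\<chi> i j. cnj (A$j$i))"

definition cscale :: "complex \<Rightarrow> complex^2^2 \<Rightarrow> complex^2^2" where
  "cscale c A = (\<chi> i j. c * A$i$j)"

definition herm :: "complex^2^2 \<Rightarrow> bool" where
  "herm A \<longleftrightarrow> cadj A = A"

text \<open>Positive semidefinite (the cone M_2^+) and positive definite (its interior).\<close>
definition psd :: "complex^2^2 \<Rightarrow> bool" where
  "psd A \<longleftrightarrow> herm A \<and> (\<forall>x. 0 \<le> Re (cinner2 x (A *v x)))"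

definition pd :: "complex^2^2 \<Rightarrow> bool" where
  "pd A \<longleftrightarrow> herm A \<and> (\<forall>x. x \<noteq> 0 \<longrightarrow> 0 < Re (cinner2 x (A *v x)))"

definition clinear_map :: "(complex^2^2 \<Rightarrow> complex^2^2) \<Rightarrow> bool" where
  "clinear_map \<Phi> \<longleftrightarrow> (\<forall>A B. \<Phi> (A + B) = \<Phi> A + \<Phi> B) \<and>
                       (\<forall>c A. \<Phi> (cscale c A) = cscale c (\<Phi> A))"

definition herm_preserving :: "(complex^2^2 \<Rightarrow> complex^2^2) \<Rightarrow> bool" where
  "herm_preserving \<Phi> \<longleftrightarrow> (\<forall>A. herm A \<longrightarrow> herm (\<Phi> A))"

definition cone_positive :: "(complex^2^2 \<Rightarrow> complex^2^2) \<Rightarrow> bool" where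
  "cone_positive \<Phi> \<longleftrightarrow> (\<forall>A. psd A \<longrightarrow> psd (\<Phi> A))"

definition strictly_cone_positive :: "(complex^2^2 \<Rightarrow> complex^2^2) \<Rightarrow> bool" where
  "strictly_cone_positive \<Phi> \<longleftrightarrow> (\<forall>A. psd A \<and> A \<noteq> 0 \<longrightarrow> pd (\<Phi> A))"

definition cone_primitive :: "(complex^2^2 \<Rightarrow> complex^2^2) \<Rightarrow> bool" where
  "cone_primitive \<Phi> \<longleftrightarrow> cone_positive \<Phi> \<and> (\<exists>k\<ge>1. strictly_cone_positive (\<Phi> ^^ k))"

definition cone_exponent :: "(complex^2^2 \<Rightarrow> complex^2^2) \<Rightarrow> nat" where
  "cone_exponent \<Phi> = (LEAST k. k \<ge> 1 \<and> strictly_cone_positive (\<Phi> ^^ k))"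

text \<open>Complete positivity: for every n, id_n tensor Phi maps positive semidefinite
  elements of M_n(M_2) (n x n block matrices with 2x2 blocks X i j) to positive
  semidefinite ones.\<close>
definition block_psd :: "nat \<Rightarrow> (nat \<Rightarrow> nat \<Rightarrow> complex^2^2) \<Rightarrow> bool" where
  "block_psd n X \<longleftrightarrow> (\<forall>i<n. \<forall>j<n. X i j = cadj (X j i)) \<and>
     (\<forall>v :: nat \<Rightarrow> complex^2. 0 \<le> Re (\<Sum>i<n. \<Sum>j<n. cinner2 (v i) (X i j *v v j)))"

definition completely_positive :: "(complex^2^2 \<Rightarrow> complex^2^2) \<Rightarrow> bool" where
  "completely_positive \<Phi> \<longleftrightarrow> (\<forall>n X. block_psd n X \<longrightarrow> block_psd n (\<lambda>i j. \<Phi> (X i j)))"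

definition max_exponent :: enat where
  "max_exponent = Sup {enat (cone_exponent \<Phi>) | \<Phi>.
      clinear_map \<Phi> \<and> herm_preserving \<Phi> \<and> cone_primitive \<Phi>}"

definition max_exponent_cp :: enat where
  "max_exponent_cp = Sup {enat (cone_exponent \<Phi>) | \<Phi>.
      clinear_map \<Phi> \<and> completely_positive \<Phi> \<and> cone_primitive \<Phi>}"

end

theory Submission
  imports Defs
begin

text \<open>On the four-dimensional real space of Hermitian matrices the positive cone is cut out by the
  determinant \<open>q\<close>, a Lorentzian form. If \<open>A\<close>, \<open>\<Phi> A\<close>, \<dots>, \<open>\<Phi>\<^sup>4 A\<close> are all singular, the S-lemma gives
  \<open>\<mu>\<close> with \<open>q (\<Phi> X) - \<mu> q X \<ge> 0\<close> for all Hermitian \<open>X\<close>. The zeros of this form are a subspace containing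
  \<open>\<Phi>\<^sup>i A\<close> for \<open>i < 4\<close>, hence the whole orbit, along which \<open>q\<close> therefore vanishes, and \<open>\<Phi>\<close> is
  not primitive.

  For completely positive \<open>\<Phi>\<close> and a singular orbit \<open>x\<^sub>i x\<^sub>i\<^sup>*\<close>, \<open>i \<le> 3\<close>, the \<open>x\<^sub>i\<close> are pairwise independent,
  so each Kraus operator maps three directions to three prescribed ones. It is thus determined up to
  a factor, and \<open>\<Phi>\<close> has a single Kraus operator and preserves singularity.\<close>

subsection \<open>The S-lemma and Krylov subspaces\<close>

lemma bilinear_expand:
  fixes q :: "'a::real_vector \<Rightarrow> 'a \<Rightarrow> real"
  assumes "bilinear q"
  shows "q (x + t *\<^sub>R y) (x + t *\<^sub>R y) = q x x + t * (q x y + q y x) + t\<^sup>2 * q y y"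
  using assms
  by (simp add: bilinear_ladd bilinear_radd bilinear_lmul bilinear_rmul algebra_simps power2_eq_square)

text \<open>Opposite signs of \<open>a\<close> and \<open>c\<close> push the discriminant above the
  square of \<open>m\<close>, so its root dominates \<open>m\<close> and the two zeros have opposite
  signs.\<close>

lemma quadratic_root_signs:
  fixes a m c :: real
  assumes "a < 0" "0 < c"
  obtains t1 t2 where "t1 < 0" "0 < t2" "c + t1 * m + t1\<^sup>2 * a = 0" "c + t2 * m + t2\<^sup>2 * a = 0"
    "t1 * t2 * a = c"
proof -
  have "a * c < 0" using assms by (simp add: mult_less_0_iff)
  then have D: "m\<^sup>2 < m\<^sup>2 - 4 * a * c" by simp
  define s where "s = sqrt (m\<^sup>2 - 4 * a * c)"
  have s: "\<bar>m\<bar> < s" using D unfolding s_def by (metis real_sqrt_abs real_sqrt_less_iff)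
  have "s\<^sup>2 = m\<^sup>2 - 4 * a * c" using D unfolding s_def by (smt (verit) real_sqrt_pow2 zero_le_power2)
  then have c: "c = (m\<^sup>2 - s\<^sup>2) / (4 * a)" using assms by (simp add: field_simps)
  show thesis
  proof (rule that[of "(s - m) / (2 * a)" "(- s - m) / (2 * a)"])
    show "(s - m) / (2 * a) < 0" "0 < (- s - m) / (2 * a)"
      using s assms by (auto simp: divide_simps)
    show "c + (s - m) / (2 * a) * m + ((s - m) / (2 * a))\<^sup>2 * a = 0"
      "c + (- s - m) / (2 * a) * m + ((- s - m) / (2 * a))\<^sup>2 * a = 0"
      "(s - m) / (2 * a) * ((- s - m) / (2 * a)) * a = c"
      unfolding c using assms by (simp_all add: divide_simps) (simp_all add: algebra_simps power2_eq_square)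
  qed
qed

text \<open>The line through \<open>x\<close> in direction \<open>y\<close> meets the null cone of
  \<open>q\<close> at parameters of opposite sign. Weighting the two inequalities for
  \<open>p\<close> by \<open>t2\<close> and \<open>- t1\<close> cancels the cross terms.\<close>

lemma S_lemma_cross:
  fixes p q :: "'a::real_vector \<Rightarrow> 'a \<Rightarrow> real"
  assumes p: "bilinear p" and q: "bilinear q" and S: "subspace S"
    and null: "\<And>z. z \<in> S \<Longrightarrow> q z z = 0 \<Longrightarrow> 0 \<le> p z z"
    and x: "x \<in> S" "0 < q x x" and y: "y \<in> S" "q y y < 0"
  shows "p y y / q y y \<le> p x x / q x x"
proof -
  obtain t1 t2 where t: "t1 < 0" "0 < t2"
    "q x x + t1 * (q x y + q y x) + t1\<^sup>2 * q y y = 0"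
    "q x x + t2 * (q x y + q y x) + t2\<^sup>2 * q y y = 0" and tt: "t1 * t2 * q y y = q x x"
    using quadratic_root_signs[OF y(2) x(2)] by metis
  have "0 \<le> p (x + t *\<^sub>R y) (x + t *\<^sub>R y)" if "t = t1 \<or> t = t2" for t
    using that t x y S by (intro null) (auto simp: bilinear_expand[OF q] subspace_add subspace_scale)
  then have 1: "0 \<le> p x x + t1 * (p x y + p y x) + t1\<^sup>2 * p y y"
    and 2: "0 \<le> p x x + t2 * (p x y + p y x) + t2\<^sup>2 * p y y"
    by (auto simp: bilinear_expand[OF p])
  have "0 \<le> t2 * (p x x + t1 * (p x y + p y x) + t1\<^sup>2 * p y y)
        + (- t1) * (p x x + t2 * (p x y + p y x) + t2\<^sup>2 * p y y)"
    using mult_nonneg_nonneg[OF less_imp_le[OF t(2)] 1] mult_nonpos_nonneg[OF less_imp_le[OF t(1)] 2]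
    by simp
  also have "\<dots> = (t2 - t1) * (p x x - t1 * t2 * p y y)"
    by (simp add: algebra_simps power2_eq_square)
  finally have "t1 * t2 * p y y \<le> p x x" using t by (simp add: zero_le_mult_iff)
  moreover have "t1 * t2 = q x x / q y y" using tt y by (simp add: field_simps)
  ultimately show ?thesis using x y by (simp add: divide_simps mult.commute split: if_splits)
qed

text \<open>The multiplier is the infimum of \<open>p / q\<close> where \<open>q\<close> is
  positive; by \<open>S_lemma_cross\<close> the ratios where \<open>q\<close> is negative are lower
  bounds.\<close>

lemma S_lemma:
  fixes p q :: "'a::real_vector \<Rightarrow> 'a \<Rightarrow> real"
  assumes p: "bilinear p" and q: "bilinear q" and S: "subspace S"
    and null: "\<And>z. z \<in> S \<Longrightarrow> q z z = 0 \<Longrightarrow> 0 \<le> p z z"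
    and x0: "x0 \<in> S" "0 < q x0 x0" and y0: "y0 \<in> S" "q y0 y0 < 0"
  obtains \<mu> where "\<And>x. x \<in> S \<Longrightarrow> \<mu> * q x x \<le> p x x"
proof -
  define T where "T = (\<lambda>x. p x x / q x x) ` {x \<in> S. 0 < q x x}"
  have lower: "p y y / q y y \<le> r" if "y \<in> S" "q y y < 0" "r \<in> T" for y r
    using that S_lemma_cross[OF p q S null] by (auto simp: T_def)
  have ne: "T \<noteq> {}" using x0 by (auto simp: T_def)
  have bdd: "bdd_below T" using lower y0 by (meson bdd_belowI)
  show thesis
  proof (rule that[of "Inf T"])
    fix x assume xS: "x \<in> S"
    consider "q x x > 0" | "q x x = 0" | "q x x < 0" by linarith
    then show "Inf T * q x x \<le> p x x"
    proof cases
      case 1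
      then have "Inf T \<le> p x x / q x x" using xS by (intro cInf_lower bdd) (auto simp: T_def)
      with 1 show ?thesis by (simp add: field_simps)
    next
      case 2 then show ?thesis using null xS by simp
    next
      case 3
      then have "p x x / q x x \<le> Inf T" using xS lower by (intro cInf_greatest ne) auto
      with 3 show ?thesis by (simp add: field_simps)
    qed
  qed
qed

text \<open>The cardinality rules out repeated vectors, which the image set would hide.\<close>

lemma krylov_independent:
  fixes v :: "nat \<Rightarrow> 'a::real_vector"
  assumes "\<And>i. i < j \<Longrightarrow> v i \<notin> span (v ` {..<i})"
  shows "independent (v ` {..<j}) \<and> card (v ` {..<j}) = j"
  using assms
proof (induction j)
  case (Suc j)
  have "v j \<notin> span (v ` {..<j})" using Suc.prems by simp
  moreover from this have "v j \<notin> v ` {..<j}" by (meson span_base)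
  ultimately show ?case using Suc by (simp add: lessThan_Suc independent_insert)
qed (simp add: independent_empty)

text \<open>Some iterate of index at most \<open>dim S\<close> lies in the span of its predecessors.
  That span is invariant and contains \<open>x\<close>, hence the orbit, and its generators lie in
  \<open>Z\<close>.\<close>

lemma krylov_orbit:
  fixes f :: "'a::euclidean_space \<Rightarrow> 'a"
  assumes f: "linear f" and S: "subspace S" "f ` S \<subseteq> S" and x: "x \<in> S"
    and Z: "subspace Z" "\<And>i. i < dim S \<Longrightarrow> (f ^^ i) x \<in> Z"
  shows "(f ^^ k) x \<in> Z"
proof -
  let ?v = "\<lambda>i. (f ^^ i) x"
  have vS: "?v i \<in> S" for i by (induction i) (use x S in auto)
  have "\<exists>j \<le> dim S. ?v j \<in> span (?v ` {..<j})"
  proof (rule ccontr)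
    assume "\<not> ?thesis"
    then have "independent (?v ` {..<Suc (dim S)}) \<and> card (?v ` {..<Suc (dim S)}) = Suc (dim S)"
      by (intro krylov_independent) auto
    moreover have "?v ` {..<Suc (dim S)} \<subseteq> S" using vS by auto
    ultimately show False by (metis independent_card_le_dim Suc_n_not_le_n)
  qed
  then obtain j where j: "j \<le> dim S" "?v j \<in> span (?v ` {..<j})" by blast
  let ?U = "span (?v ` {..<j})"
  have "f u \<in> ?U" if "u \<in> ?U" for u
  proof -
    have "f u \<in> span (f ` ?v ` {..<j})" using that f by (metis imageI linear_span_image)
    also have "\<dots> \<subseteq> ?U"
    proof (rule span_minimal)
      show "f ` ?v ` {..<j} \<subseteq> ?U"
      proof
        fix w assume "w \<in> f ` ?v ` {..<j}"
        then obtain i where i: "i < j" "w = ?v (Suc i)" by auto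
        then consider "Suc i < j" | "Suc i = j" by linarith
        then show "w \<in> ?U"
        proof cases
          case 1 then show ?thesis unfolding i(2) by (intro span_base imageI) simp
        next
          case 2 then show ?thesis unfolding i(2) using j(2) by simp
        qed
      qed
    qed simp
    finally show ?thesis .
  qed
  moreover have "x \<in> ?U"
  proof (cases "j = 0")
    case True then show ?thesis using j(2) by simp
  next
    case False
    then show ?thesis by (intro span_base image_eqI[of x ?v 0]) auto
  qed
  ultimately have "?v k \<in> ?U" by (induction k) auto
  moreover have "?U \<subseteq> Z" using Z j(1) by (intro span_minimal) auto
  ultimately show ?thesis by blast
qed

text \<open>By the parallelogram law the nonnegative values at \<open>x + y\<close> and
  \<open>x - y\<close> sum to zero.\<close>

lemma subspace_isotropic:
  fixes r :: "'a::real_vector \<Rightarrow> 'a \<Rightarrow> real"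
  assumes r: "bilinear r" and S: "subspace S" and nonneg: "\<And>x. x \<in> S \<Longrightarrow> 0 \<le> r x x"
  shows "subspace {x \<in> S. r x x = 0}"
proof (rule subspaceI)
  fix x y assume "x \<in> {x \<in> S. r x x = 0}" "y \<in> {x \<in> S. r x x = 0}"
  then have xy: "x \<in> S" "y \<in> S" "r x x = 0" "r y y = 0" by auto
  then have "0 \<le> r (x + y) (x + y)" "0 \<le> r (x - y) (x - y)"
    by (auto intro!: nonneg subspace_add subspace_diff S)
  moreover have "r (x + y) (x + y) + r (x - y) (x - y) = 2 * r x x + 2 * r y y"
    using bilinear_expand[OF r, of x 1 y] bilinear_expand[OF r, of x "-1" y] by simp
  ultimately show "x + y \<in> {x \<in> S. r x x = 0}" using xy S by (auto simp: subspace_add)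
qed (use r S in \<open>auto simp: subspace_0 subspace_scale bilinear_lzero bilinear_lmul bilinear_rmul\<close>)

subsection \<open>Hermitian matrices of size two\<close>

text \<open>On Hermitian matrices the quadratic form of \<open>mpol\<close> is the determinant.\<close>
definition mpol :: "complex^2^2 \<Rightarrow> complex^2^2 \<Rightarrow> real" where
  "mpol A B = Re (A$1$1) * Re (B$2$2) - A$1$2 \<bullet> B$1$2"

definition outer :: "complex^2 \<Rightarrow> complex^2 \<Rightarrow> complex^2^2" where
  "outer x y = (\<chi> i j. x$i * cnj (y$j))"

lemma mpol_self: "mpol A A = Re (A$1$1) * Re (A$2$2) - (cmod (A$1$2))\<^sup>2"
  by (simp add: mpol_def power2_norm_eq_inner)

lemma mpol_parts: "mpol A A = Re (A$1$1) * Re (A$2$2) - ((Re (A$1$2))\<^sup>2 + (Im (A$1$2))\<^sup>2)"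
  by (simp add: mpol_self cmod_power2)

lemma bilinear_mpol: "bilinear mpol"
  unfolding bilinear_def
  by (auto intro!: linearI simp: mpol_def algebra_simps)

lemma herm_iff: "herm A \<longleftrightarrow> Im (A$1$1) = 0 \<and> Im (A$2$2) = 0 \<and> A$2$1 = cnj (A$1$2)"
  by (auto simp: herm_def cadj_def vec_eq_iff forall_2 complex_eq_iff)

lemma subspace_herm: "subspace {A. herm A}"
  by (auto intro!: subspaceI simp: herm_iff)

lemma herm_form:
  assumes "herm A"
  shows "Re (cinner2 x (A *v x))
    = Re (A$1$1) * (cmod (x$1))\<^sup>2 + Re (A$2$2) * (cmod (x$2))\<^sup>2 + 2 * Re (cnj (x$1) * A$1$2 * x$2)"
  using assms unfolding herm_iff cmod_power2
  by (simp add: cinner2_def matrix_vector_mult_def sum_2 algebra_simps power2_eq_square)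

text \<open>Completing the square.\<close>

lemma herm_form_square1:
  assumes "herm A"
  shows "Re (A$1$1) * Re (cinner2 x (A *v x))
    = (cmod (Re (A$1$1) * x$1 + A$1$2 * x$2))\<^sup>2 + mpol A A * (cmod (x$2))\<^sup>2"
  unfolding herm_form[OF assms] mpol_parts cmod_power2
  by (simp add: algebra_simps power2_eq_square)

lemma psdD:
  assumes "psd A"
  shows "herm A" "0 \<le> Re (A$1$1)" "0 \<le> Re (A$2$2)" "0 \<le> mpol A A"
proof -
  show h: "herm A" using assms by (simp add: psd_def)
  have f: "0 \<le> Re (A$1$1) * (cmod (x$1))\<^sup>2 + Re (A$2$2) * (cmod (x$2))\<^sup>2
      + 2 * Re (cnj (x$1) * A$1$2 * x$2)" for x :: "complex^2"
    using assms herm_form[OF h] by (simp add: psd_def)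
  show a: "0 \<le> Re (A$1$1)" using f[of "vector [1, 0]"] by simp
  show d: "0 \<le> Re (A$2$2)" using f[of "vector [0, 1]"] by simp
  \<comment> \<open>This test vector and the next give a diagonal entry times the determinant. If
    both diagonal entries vanish, the third one forces the off-diagonal entry to be zero.\<close>
  have 1: "0 \<le> Re (A$1$1) * mpol A A"
    using f[of "vector [- A$1$2, Re (A$1$1)]"] unfolding mpol_parts cmod_power2
    by (simp add: algebra_simps power2_eq_square)
  have 2: "0 \<le> Re (A$2$2) * mpol A A"
    using f[of "vector [Re (A$2$2), - cnj (A$1$2)]"] unfolding mpol_parts cmod_power2
    by (simp add: algebra_simps power2_eq_square)
  have 3: "0 \<le> - 2 * (cmod (A$1$2))\<^sup>2" if "Re (A$1$1) = 0" "Re (A$2$2) = 0"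
    using f[of "vector [- A$1$2, 1]"] that unfolding cmod_power2
    by (simp add: algebra_simps power2_eq_square)
  show "0 \<le> mpol A A"
  proof (cases "Re (A$1$1) = 0 \<and> Re (A$2$2) = 0")
    case True with 3 show ?thesis by (simp add: mpol_self)
  next
    case False with 1 2 a d show ?thesis by (metis linorder_not_less mult_pos_neg order_le_less)
  qed
qed

lemma psdI:
  assumes h: "herm A" and a: "0 \<le> Re (A$1$1)" and d: "0 \<le> Re (A$2$2)" and q: "0 \<le> mpol A A"
  shows "psd A"
  unfolding psd_def
proof (intro conjI allI h)
  fix x
  show "0 \<le> Re (cinner2 x (A *v x))"
  proof (cases "Re (A$1$1) = 0")
    case True
    then have "A$1$2 = 0" using q by (simp add: mpol_self)
    with True d show ?thesis by (simp add: herm_form[OF h])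
  next
    case False
    have "0 \<le> Re (A$1$1) * Re (cinner2 x (A *v x))"
      unfolding herm_form_square1[OF h] using q by simp
    with False a show ?thesis by (simp add: zero_le_mult_iff)
  qed
qed

lemma psd_iff: "psd A \<longleftrightarrow> herm A \<and> 0 \<le> Re (A$1$1) \<and> 0 \<le> Re (A$2$2) \<and> 0 \<le> mpol A A"
  using psdD psdI by blast

lemma pd_imp_psd: "pd A \<Longrightarrow> psd A"
  unfolding pd_def psd_def cinner2_def by (metis (no_types, lifting) less_imp_le order_refl
      mult_zero_left complex_cnj_zero sum.neutral zero_complex.simps(1) zero_index)

lemma pd_iff: "pd A \<longleftrightarrow> herm A \<and> 0 < Re (A$1$1) \<and> 0 < mpol A A"
proof
  assume A: "pd A"
  then have h: "herm A" and p: "psd A" by (auto simp: pd_def intro: pd_imp_psd)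
  have f: "x \<noteq> 0 \<Longrightarrow> 0 < Re (A$1$1) * (cmod (x$1))\<^sup>2 + Re (A$2$2) * (cmod (x$2))\<^sup>2
      + 2 * Re (cnj (x$1) * A$1$2 * x$2)" for x :: "complex^2"
    using A herm_form[OF h] by (simp add: pd_def)
  have a: "0 < Re (A$1$1)" using f[of "vector [1, 0]"] by (simp add: vec_eq_iff forall_2)
  then have "0 < Re (A$1$1) * mpol A A"
    using f[of "vector [- A$1$2, Re (A$1$1)]"] unfolding mpol_parts cmod_power2
    by (simp add: algebra_simps power2_eq_square vec_eq_iff forall_2)
  with a h show "herm A \<and> 0 < Re (A$1$1) \<and> 0 < mpol A A" by (simp add: zero_less_mult_iff)
next
  assume A: "herm A \<and> 0 < Re (A$1$1) \<and> 0 < mpol A A"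
  show "pd A" unfolding pd_def
  proof (intro conjI allI impI)
    fix x :: "complex^2" assume "x \<noteq> 0"
    then have x: "x$1 \<noteq> 0 \<or> x$2 \<noteq> 0" by (auto simp: vec_eq_iff forall_2)
    have "0 < Re (A$1$1) * Re (cinner2 x (A *v x))"
    proof (cases "x$2 = 0")
      case True with A x show ?thesis by (simp add: herm_form_square1 zero_less_mult_iff)
    next
      case False with A show ?thesis by (simp add: herm_form_square1 add_nonneg_pos)
    qed
    with A show "0 < Re (cinner2 x (A *v x))" by (simp add: zero_less_mult_iff)
  qed (use A in simp)
qed

lemma psd_not_pd_mpol:
  assumes "psd A" "\<not> pd A"
  shows "mpol A A = 0"
  using assms unfolding psd_iff pd_iff
  by (cases "Re (A$1$1) = 0") (auto simp: mpol_self)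

text \<open>Determinant zero means rank at most one; \<open>x\<close> is the first column divided by
  the square root of the first diagonal entry, when that entry is nonzero.\<close>

lemma psd_not_pd_outer:
  assumes "psd A" "\<not> pd A"
  obtains x where "A = outer x x"
proof -
  have h: "Im (A$1$1) = 0" "Im (A$2$2) = 0" "A$2$1 = cnj (A$1$2)"
    and a: "0 \<le> Re (A$1$1)" and d: "0 \<le> Re (A$2$2)" using psdD[OF assms(1)] by (auto simp: herm_iff)
  have q: "Re (A$1$1) * Re (A$2$2) = (cmod (A$1$2))\<^sup>2"
    using psd_not_pd_mpol[OF assms] by (simp add: mpol_self)
  have A1: "A$1$1 = Re (A$1$1)" "A$2$2 = Re (A$2$2)" using h by (auto simp: complex_eq_iff)
  show thesis
  proof (cases "Re (A$1$1) = 0")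
    case True
    then have "A$1$2 = 0" using q by simp
    then have "A = outer (vector [0, sqrt (Re (A$2$2))]) (vector [0, sqrt (Re (A$2$2))])"
      using h d True A1
      by (simp add: vec_eq_iff forall_2 outer_def flip: of_real_mult)
    then show thesis by (rule that)
  next
    case False
    let ?s = "sqrt (Re (A$1$1))"
    have s: "?s \<noteq> 0" "complex_of_real ?s * ?s = A$1$1" using False a A1 by (auto simp flip: of_real_mult)
    have "A$1$1 * A$2$2 = cnj (A$1$2) * A$1$2"
      using q A1 by (metis complex_norm_square mult.commute of_real_mult)
    moreover have "A$1$1 \<noteq> 0" using False by auto
    ultimately have "A$2$2 = cnj (A$1$2) / ?s * (A$1$2 / ?s)"
      unfolding times_divide_times_eq s(2) by (simp add: nonzero_eq_divide_eq mult.commute)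
    then have "A = outer (vector [?s, cnj (A$1$2) / ?s]) (vector [?s, cnj (A$1$2) / ?s])"
      using h s by (simp add: vec_eq_iff forall_2 outer_def)
    then show thesis by (rule that)
  qed
qed

subsection \<open>Primitive maps\<close>

lemma not_pd_0: "\<not> pd 0"
  by (simp add: pd_iff)

lemma clinear_imp_linear:
  assumes "clinear_map \<Phi>"
  shows "linear \<Phi>"
proof -
  have "r *\<^sub>R A = cscale (complex_of_real r) A" for r A
    by (simp add: vec_eq_iff cscale_def complex_eq_iff)
  with assms show ?thesis by (auto intro!: linearI simp: clinear_map_def)
qed

lemma linear_cinner2_form: "linear (\<lambda>A. Re (cinner2 x (A *v x)))"
  by (auto intro!: linearI simp: cinner2_def matrix_vector_mult_def sum_2 algebra_simps)

lemma psd_funpow: "cone_positive \<Phi> \<Longrightarrow> psd A \<Longrightarrow> psd ((\<Phi> ^^ k) A)"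
  by (induction k) (auto simp: cone_positive_def)

text \<open>Interior points are order units. The three summands of \<open>t\<close> take care of the
  two diagonal entries and of the determinant, which is quadratic in \<open>t\<close>.\<close>

lemma pd_dominates:
  assumes B: "pd B" and C: "psd C"
  obtains t where "psd (t *\<^sub>R B - C)"
proof -
  define m where "m = mpol C B + mpol B C"
  define t where "t = \<bar>Re (C$1$1)\<bar> / Re (B$1$1) + \<bar>Re (C$2$2)\<bar> / Re (B$2$2) + \<bar>m\<bar> / mpol B B"
  have hB: "herm B" and a: "0 < Re (B$1$1)" and q: "0 < mpol B B" using B by (auto simp: pd_iff)
  have d: "0 < Re (B$2$2)" using a q by (smt (verit) mpol_self zero_less_mult_pos zero_le_power2)
  note C = psdD[OF C]
  have t: "\<bar>Re (C$1$1)\<bar> / Re (B$1$1) \<le> t" "\<bar>Re (C$2$2)\<bar> / Re (B$2$2) \<le> t" "\<bar>m\<bar> / mpol B B \<le> t" "0 \<le> t"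
    unfolding t_def using a d q by auto
  have "mpol (t *\<^sub>R B - C) (t *\<^sub>R B - C) = t * (t * mpol B B - m) + mpol C C"
    using bilinear_expand[OF bilinear_mpol, of "- C" t B] bilinear_mpol
    by (simp add: m_def bilinear_lneg bilinear_rneg algebra_simps power2_eq_square)
  moreover have "0 \<le> t * mpol B B - m" using t(3) q by (simp add: field_simps)
  ultimately have "0 \<le> mpol (t *\<^sub>R B - C) (t *\<^sub>R B - C)" using t(4) C by simp
  moreover have "Re (C$1$1) \<le> t * Re (B$1$1)" "Re (C$2$2) \<le> t * Re (B$2$2)"
    using t(1,2) a d C by (simp_all add: field_simps)
  moreover have "herm (t *\<^sub>R B - C)" using hB C(1) by (simp add: herm_iff)
  ultimately show thesis by (intro that[of t]) (simp add: psd_iff)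
qed

text \<open>If \<open>\<Phi> B\<close> vanishes on a vector \<open>x\<close>, then the functional \<open>A \<mapsto> \<langle>x, \<Phi> A x\<rangle>\<close>, being nonnegative on
  the cone and zero at the interior point \<open>B\<close>, is zero.\<close>
lemma singular_image:
  assumes lin: "linear \<Phi>" and pos: "cone_positive \<Phi>"
    and B: "pd B" "\<not> pd (\<Phi> B)" and C: "psd C"
  shows "\<not> pd (\<Phi> C)"
proof -
  have "psd (\<Phi> B)" using pos B pd_imp_psd by (auto simp: cone_positive_def)
  then obtain x where x: "x \<noteq> 0" "Re (cinner2 x (\<Phi> B *v x)) \<le> 0"
    using B(2) by (auto simp: pd_def psd_def not_less)
  obtain t where t: "psd (t *\<^sub>R B - C)" using pd_dominates[OF B(1) C] .
  let ?f = "\<lambda>A. Re (cinner2 x (\<Phi> A *v x))"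
  have "linear ?f" using linear_compose[OF lin linear_cinner2_form[of x]] by (simp add: o_def)
  then have "?f (t *\<^sub>R B - C) = t * ?f B - ?f C" 
    using linear_diff[of ?f "t *\<^sub>R B" C] linear_cmul[of ?f t B] by simp
  moreover have "0 \<le> ?f (t *\<^sub>R B - C)" using pos t by (auto simp: cone_positive_def psd_def)
  moreover have "?f B = 0" using x(2) \<open>psd (\<Phi> B)\<close> by (force simp: psd_def intro: antisym)
  ultimately have "?f C \<le> 0" by simp
  with x(1) show ?thesis by (auto simp: pd_def not_less)
qed

text \<open>Otherwise \<open>singular_image\<close> with \<open>C = (\<Phi> ^^ l) B\<close> would
  deny positive definiteness to every later iterate of \<open>B\<close>.\<close>

lemma primitive_pd:
  assumes lin: "linear \<Phi>" and prim: "cone_primitive \<Phi>" and B: "pd B"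
  shows "pd (\<Phi> B)"
proof (rule ccontr)
  assume "\<not> pd (\<Phi> B)"
  from prim obtain k where pos: "cone_positive \<Phi>" and k: "k \<ge> 1" "strictly_cone_positive (\<Phi> ^^ k)"
    by (auto simp: cone_primitive_def)
  have "pd ((\<Phi> ^^ k) B)"
    using k(2) B pd_imp_psd not_pd_0 unfolding strictly_cone_positive_def by metis
  moreover obtain l where "k = Suc l" using k(1) by (cases k) auto
  ultimately show False
    using singular_image[OF lin pos B \<open>\<not> pd (\<Phi> B)\<close> psd_funpow[OF pos pd_imp_psd[OF B], of l]] by simp
qed

lemma primitive_pd_funpow_mono:
  assumes "linear \<Phi>" "cone_primitive \<Phi>" "pd ((\<Phi> ^^ i) A)" "i \<le> j"
  shows "pd ((\<Phi> ^^ j) A)"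
  using assms(4,3) by (induction j rule: dec_induct) (auto intro: primitive_pd[OF assms(1,2)])

lemma primitive_not_always_singular:
  assumes "linear \<Phi>" "cone_primitive \<Phi>" "psd A" "A \<noteq> 0"
  obtains k where "\<And>i. k \<le> i \<Longrightarrow> pd ((\<Phi> ^^ i) A)"
  using assms primitive_pd_funpow_mono[OF assms(1,2)]
  unfolding cone_primitive_def strictly_cone_positive_def by meson

text \<open>Positive definiteness persists along the orbit, and a zero iterate would stay zero
  forever.\<close>

lemma primitive_orbit:
  assumes "linear \<Phi>" "cone_primitive \<Phi>" "psd A" "A \<noteq> 0" and n: "\<not> pd ((\<Phi> ^^ n) A)" and "i \<le> n"
  shows "psd ((\<Phi> ^^ i) A)" "\<not> pd ((\<Phi> ^^ i) A)" "(\<Phi> ^^ i) A \<noteq> 0"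
proof -
  show "psd ((\<Phi> ^^ i) A)" using assms by (auto simp: cone_primitive_def intro: psd_funpow)
  show "\<not> pd ((\<Phi> ^^ i) A)" using assms primitive_pd_funpow_mono by blast
  obtain k where k: "\<And>i. k \<le> i \<Longrightarrow> pd ((\<Phi> ^^ i) A)"
    using primitive_not_always_singular assms(1-4) by blast
  show "(\<Phi> ^^ i) A \<noteq> 0"
  proof
    assume 0: "(\<Phi> ^^ i) A = 0"
    have "(\<Phi> ^^ j) A = 0" if "i \<le> j" for j
      using that by (induction j rule: dec_induct) (auto simp: 0 linear_0[OF assms(1)])
    then show False using k[of "max i k"] not_pd_0 by simp
  qed
qed

subsection \<open>The maximal exponent\<close>

lemma dim_herm: "dim {A. herm A} \<le> 4"
proof -
  let ?E = "\<lambda>a b c d. vector [vector [a, b], vector [c, d]] :: complex^2^2"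
  let ?B = "{?E 1 0 0 0, ?E 0 0 0 1, ?E 0 1 1 0, ?E 0 \<i> (- \<i>) 0}"
  have "A \<in> span ?B" if "herm A" for A
  proof -
    have "A = Re (A$1$1) *\<^sub>R ?E 1 0 0 0 + Re (A$2$2) *\<^sub>R ?E 0 0 0 1
        + Re (A$1$2) *\<^sub>R ?E 0 1 1 0 + Im (A$1$2) *\<^sub>R ?E 0 \<i> (- \<i>) 0"
      using that by (simp add: herm_iff vec_eq_iff forall_2 complex_eq_iff)
    also have "\<dots> \<in> span ?B" by (intro span_add span_scale span_base) auto
    finally show ?thesis .
  qed
  then have "dim {A. herm A} \<le> card ?B" by (intro dim_le_card) auto
  also have "\<dots> \<le> 4" by (simp add: card_insert_if)
  finally show ?thesis .
qed

lemma primitive_strictly_positive_4: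
  assumes clin: "clinear_map \<Phi>" and hp: "herm_preserving \<Phi>" and prim: "cone_primitive \<Phi>"
  shows "strictly_cone_positive (\<Phi> ^^ 4)"
  unfolding strictly_cone_positive_def
proof (intro allI impI, elim conjE, rule ccontr)
  fix A assume A: "psd A" "A \<noteq> 0" and bad: "\<not> pd ((\<Phi> ^^ 4) A)"
  let ?H = "{A. herm A}"
  let ?p = "\<lambda>A B. mpol (\<Phi> A) (\<Phi> B)"
  have lin: "linear \<Phi>" using clin by (rule clinear_imp_linear)
  have pos: "cone_positive \<Phi>" using prim by (simp add: cone_primitive_def)
  have bp: "bilinear ?p"
    using bilinear_mpol lin unfolding bilinear_def
    by (auto intro: linear_compose[OF lin, unfolded o_def])
  \<comment> \<open>Up to sign, a Hermitian matrix of determinant zero is semidefinite, and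
    \<open>?p\<close> takes the same value at \<open>Z\<close> and \<open>- Z\<close>.\<close>
  have null: "0 \<le> ?p Z Z" if "Z \<in> ?H" "mpol Z Z = 0" for Z
  proof -
    have "Re (Z$1$1) * Re (Z$2$2) \<ge> 0" using that by (simp add: mpol_self)
    then consider "0 \<le> Re (Z$1$1)" "0 \<le> Re (Z$2$2)" | "Re (Z$1$1) \<le> 0" "Re (Z$2$2) \<le> 0"
      by (auto simp: zero_le_mult_iff)
    then have "psd Z \<or> psd (- Z)"
      using that by cases (auto simp: psd_iff herm_iff bilinear_lneg[OF bilinear_mpol] bilinear_rneg[OF bilinear_mpol])
    then have "psd (\<Phi> Z) \<or> psd (- \<Phi> Z)"
      using pos linear_neg[OF lin, of Z] by (auto simp: cone_positive_def)
    then show ?thesis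
      by (auto simp: bilinear_lneg[OF bilinear_mpol] bilinear_rneg[OF bilinear_mpol] dest: psdD(4))
  qed
  have "\<exists>X\<in>?H. 0 < mpol X X"
    by (rule bexI[of _ "mat 1"]) (auto simp: mpol_self mat_def herm_iff)
  moreover have "\<exists>X\<in>?H. mpol X X < 0"
    by (rule bexI[of _ "vector [vector [0, 1], vector [1, 0]]"]) (auto simp: mpol_self herm_iff)
  ultimately obtain \<mu> where \<mu>: "\<And>X. X \<in> ?H \<Longrightarrow> \<mu> * mpol X X \<le> ?p X X"
    using S_lemma[OF bp bilinear_mpol subspace_herm null] by blast
  define r where "r = (\<lambda>X Y. ?p X Y - \<mu> * mpol X Y)"
  have br: "bilinear r"
    unfolding r_def bilinear_def
    by (auto intro!: linearI simp: algebra_simps bilinear_ladd[OF bp] bilinear_radd[OF bp]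
        bilinear_lmul[OF bp] bilinear_rmul[OF bp] bilinear_ladd[OF bilinear_mpol]
        bilinear_radd[OF bilinear_mpol] bilinear_lmul[OF bilinear_mpol] bilinear_rmul[OF bilinear_mpol])
  let ?Z = "{X \<in> ?H. r X X = 0}"
  have Z: "subspace ?Z"
    using \<mu> by (intro subspace_isotropic br subspace_herm) (auto simp: r_def)
  have null_orbit: "herm ((\<Phi> ^^ i) A)" "mpol ((\<Phi> ^^ i) A) ((\<Phi> ^^ i) A) = 0" if "i \<le> 4" for i
    using primitive_orbit[OF lin prim A bad that] by (auto intro: psdD psd_not_pd_mpol)
  \<comment> \<open>Membership uses two consecutive singular iterates, so indices below
    \<open>dim ?H\<close>, at most four, call on iterates up to the fourth.\<close>
  have "(\<Phi> ^^ i) A \<in> ?Z" if "i < dim ?H" for i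
    using that dim_herm null_orbit[of i] null_orbit[of "Suc i"] by (auto simp: r_def)
  moreover have "\<Phi> ` ?H \<subseteq> ?H" using hp by (auto simp: herm_preserving_def)
  ultimately have "(\<Phi> ^^ i) A \<in> ?Z" for i
    using krylov_orbit[OF lin subspace_herm _ _ Z] psdD(1)[OF A(1)] by blast
  \<comment> \<open>Vanishing of \<open>r\<close> on the orbit says that each step multiplies the
    determinant by \<open>\<mu>\<close>.\<close>
  then have step: "mpol ((\<Phi> ^^ Suc i) A) ((\<Phi> ^^ Suc i) A) = \<mu> * mpol ((\<Phi> ^^ i) A) ((\<Phi> ^^ i) A)" for i
    by (simp add: r_def)
  have zero: "mpol ((\<Phi> ^^ i) A) ((\<Phi> ^^ i) A) = 0" for i
    by (induction i) (use null_orbit[of 0] step in auto)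
  obtain k where "\<And>i. k \<le> i \<Longrightarrow> pd ((\<Phi> ^^ i) A)"
    using primitive_not_always_singular[OF lin prim A] by blast
  then have "pd ((\<Phi> ^^ k) A)" by simp
  with zero show False by (simp add: pd_iff)
qed

section \<open>Computing exponents, and a positive map of exponent four\<close>

lemma pd_if_mpol_nonzero: "psd A \<Longrightarrow> mpol A A \<noteq> 0 \<Longrightarrow> pd A"
  using psd_not_pd_mpol by blast

lemma cone_exponent_le: "1 \<le> k \<Longrightarrow> strictly_cone_positive (\<Phi> ^^ k) \<Longrightarrow> cone_exponent \<Phi> \<le> k"
  unfolding cone_exponent_def by (intro Least_le) simp

text \<open>Positive definiteness persists along orbits, so one \<open>A\<close> failing it at time
  \<open>n\<close> excludes all exponents up to \<open>n\<close>.\<close>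

lemma cone_exponent_eqI:
  assumes lin: "linear \<Phi>" and pos: "cone_positive \<Phi>" and str: "strictly_cone_positive (\<Phi> ^^ Suc n)"
    and A: "psd A" "A \<noteq> 0" "\<not> pd ((\<Phi> ^^ n) A)"
  shows "cone_primitive \<Phi>" "cone_exponent \<Phi> = Suc n"
proof -
  show prim: "cone_primitive \<Phi>"
    unfolding cone_primitive_def using pos str by (intro conjI exI[of _ "Suc n"]) auto
  show "cone_exponent \<Phi> = Suc n"
    unfolding cone_exponent_def
  proof (rule Least_equality)
    fix k assume "1 \<le> k \<and> strictly_cone_positive (\<Phi> ^^ k)"
    then have "pd ((\<Phi> ^^ k) A)" using A by (auto simp: strictly_cone_positive_def)
    then show "Suc n \<le> k"
      using A(3) primitive_pd_funpow_mono[OF lin prim] by (meson not_less_eq_eq)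
  qed (use str in simp)
qed

text \<open>The map \<open>A \<mapsto> S ((A + A\<^sup>T) / 2) S\<^sup>*\<close> for \<open>S = [[\<i>, -1], [1, -1]]\<close>. It preserves singularity of
  \<open>x x\<^sup>*\<close> only for real directions \<open>x\<close>, and the Moebius map of \<open>S\<close> sends \<open>0 \<mapsto> 1 \<mapsto> \<infinity> \<mapsto> \<i>\<close>.\<close>
definition symmetrize_twist :: "complex^2^2 \<Rightarrow> complex^2^2" where
  "symmetrize_twist A = (let a = A$1$1; d = A$2$2; r = (A$1$2 + A$2$1) / 2 in
     vector [vector [a + d, (d - r) + \<i> * (a - r)], vector [(d - r) - \<i> * (a - r), a + d - 2 * r]])"

text \<open>Averaging with the transpose deletes \<open>Im (A$1$2)\<close>, which adds its square to
  the determinant; conjugation by \<open>S\<close> then doubles it, as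
  \<open>det S = 1 - \<i>\<close>.\<close>

lemma symmetrize_twist_parts:
  assumes "herm A"
  defines "B \<equiv> symmetrize_twist A"
  shows "herm B" "Re (B$1$1) = Re (A$1$1) + Re (A$2$2)"
    "Re (B$2$2) = Re (A$1$1) + Re (A$2$2) - 2 * Re (A$1$2)"
    "Re (B$1$2) = Re (A$2$2) - Re (A$1$2)" "Im (B$1$2) = Re (A$1$1) - Re (A$1$2)"
    "mpol B B = 2 * (mpol A A + (Im (A$1$2))\<^sup>2)"
proof -
  show "herm B" and p: "Re (B$1$1) = Re (A$1$1) + Re (A$2$2)"
    "Re (B$2$2) = Re (A$1$1) + Re (A$2$2) - 2 * Re (A$1$2)"
    "Re (B$1$2) = Re (A$2$2) - Re (A$1$2)" "Im (B$1$2) = Re (A$1$1) - Re (A$1$2)"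
    using assms(1) by (auto simp: B_def herm_iff symmetrize_twist_def Let_def complex_eq_iff)
  show "mpol B B = 2 * (mpol A A + (Im (A$1$2))\<^sup>2)"
    unfolding mpol_parts p by (simp add: algebra_simps power2_eq_square)
qed

lemma symmetrize_twist_clinear: "clinear_map symmetrize_twist"
  by (auto simp: clinear_map_def symmetrize_twist_def Let_def cscale_def vec_eq_iff forall_2 field_simps)

lemma symmetrize_twist_positive: "cone_positive symmetrize_twist"
  unfolding cone_positive_def
proof (intro allI impI)
  fix A assume "psd A"
  note A = psdD[OF this]
  \<comment> \<open>The arithmetic-geometric mean inequality makes the second diagonal entry of the
    image nonnegative.\<close>
  have "4 * (Re (A$1$2))\<^sup>2 \<le> 4 * (Re (A$1$1) * Re (A$2$2))"
    using A(4) unfolding mpol_parts by (smt (verit) zero_le_power2)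
  also have "\<dots> \<le> (Re (A$1$1) + Re (A$2$2))\<^sup>2"
    using sum_squares_ge_zero[of "Re (A$1$1) - Re (A$2$2)" 0] by (simp add: algebra_simps power2_eq_square)
  finally have "(2 * Re (A$1$2))\<^sup>2 \<le> (Re (A$1$1) + Re (A$2$2))\<^sup>2" by (simp add: power_mult_distrib)
  then have "2 * Re (A$1$2) \<le> Re (A$1$1) + Re (A$2$2)"
    by (rule power2_le_imp_le) (use A in simp)
  with A show "psd (symmetrize_twist A)" by (simp add: psd_iff symmetrize_twist_parts)
qed

lemma symmetrize_twist_strict: "strictly_cone_positive (symmetrize_twist ^^ 4)"
  unfolding strictly_cone_positive_def
proof (intro allI impI, elim conjE)
  fix A assume A: "psd A" "A \<noteq> 0"
  have h: "herm A" and nn: "0 \<le> mpol A A" using A(1) by (auto dest: psdD)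
  let ?a = "Re (A$1$1)" and ?d = "Re (A$2$2)" and ?r = "Re (A$1$2)" and ?s = "Im (A$1$2)"
  let ?B = "(symmetrize_twist ^^ 4) A"
  \<comment> \<open>The determinant recursion unfolds into weighted squares of the imaginary
    off-diagonal parts of the iterates \<open>0\<close> to \<open>3\<close>.\<close>
  have "mpol ?B ?B = 16 * (mpol A A + ?s\<^sup>2) + 8 * (?a - ?r)\<^sup>2 + 4 * (?a + ?r)\<^sup>2 + 2 * (?a + 2 * ?d - ?r)\<^sup>2"
    by (simp add: eval_nat_numeral(2,3) symmetrize_twist_parts h algebra_simps)
  moreover have "mpol A A + ?s\<^sup>2 \<noteq> 0 \<or> ?a - ?r \<noteq> 0 \<or> ?a + ?r \<noteq> 0 \<or> ?a + 2 * ?d - ?r \<noteq> 0"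
  proof (rule ccontr)
    assume "\<not> ?thesis"
    then have "?a = 0 \<and> ?r = 0 \<and> ?d = 0 \<and> ?s = 0"
      using nn by (auto simp: add_nonneg_eq_0_iff)
    with h have "A = 0" by (simp add: herm_iff vec_eq_iff forall_2 complex_eq_iff)
    with A(2) show False by simp
  qed
  ultimately have "mpol ?B ?B \<noteq> 0"
    using nn by (smt (verit) zero_le_power2 zero_eq_power2)
  then show "pd ?B"
    using psd_funpow[OF symmetrize_twist_positive A(1)] by (intro pd_if_mpol_nonzero) auto
qed

lemma symmetrize_twist_exponent:
  "cone_primitive symmetrize_twist" "cone_exponent symmetrize_twist = 4"
proof -
  \<comment> \<open>This is the direction \<open>0\<close> for the ratio \<open>x$1 / x$2\<close>;
    its orbit first becomes non-real at the third step.\<close>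
  let ?A = "vector [vector [0, 0], vector [0, 1]] :: complex^2^2"
  have A: "psd ?A" "?A \<noteq> 0" by (auto simp: psd_iff herm_iff mpol_self vec_eq_iff forall_2)
  have A0: "mpol ?A ?A = 0" by (simp add: mpol_self)
  have "mpol ((symmetrize_twist ^^ 3) ?A) ((symmetrize_twist ^^ 3) ?A) = 0"
    using psdD(1)[OF A(1)] A0 by (simp add: eval_nat_numeral(2,3) symmetrize_twist_parts)
  then have "\<not> pd ((symmetrize_twist ^^ 3) ?A)" by (simp add: pd_iff)
  note * = cone_exponent_eqI[OF clinear_imp_linear[OF symmetrize_twist_clinear]
      symmetrize_twist_positive _ A this]
  show "cone_primitive symmetrize_twist" "cone_exponent symmetrize_twist = 4"
    using * symmetrize_twist_strict by (simp_all add: eval_nat_numeral)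
qed

theorem max_exponent_eq: "max_exponent = 4"
  unfolding max_exponent_def
proof (intro antisym Sup_least Sup_upper)
  fix e assume "e \<in> {enat (cone_exponent \<Phi>) |\<Phi>. clinear_map \<Phi> \<and> herm_preserving \<Phi> \<and> cone_primitive \<Phi>}"
  then show "e \<le> 4"
    by (auto simp: numeral_eq_enat intro!: cone_exponent_le primitive_strictly_positive_4)
next
  show "4 \<in> {enat (cone_exponent \<Phi>) |\<Phi>. clinear_map \<Phi> \<and> herm_preserving \<Phi> \<and> cone_primitive \<Phi>}"
    using symmetrize_twist_exponent symmetrize_twist_clinear symmetrize_twist_parts(1)
    by (auto simp: numeral_eq_enat herm_preserving_def intro!: exI[of _ symmetrize_twist])
qed

subsection \<open>The maximal exponent of completely positive maps\<close>

text \<open>Measurement in the standard basis: the outcomes \<open>e\<^sub>1\<close>, \<open>e\<^sub>2\<close> prepare \<open>e\<^sub>2\<close> and \<open>e\<^sub>1 + e\<^sub>2\<close>.\<close>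
definition measure_prepare :: "complex^2^2 \<Rightarrow> complex^2^2" where
  "measure_prepare A = vector [vector [A$2$2, A$2$2], vector [A$2$2, A$1$1 + A$2$2]]"

lemma measure_prepare_clinear: "clinear_map measure_prepare"
  by (auto simp: clinear_map_def measure_prepare_def cscale_def vec_eq_iff forall_2 algebra_simps)

text \<open>A Kraus decomposition: the adjoint Kraus operators send \<open>v\<close> to
  \<open>vector [v$2, 0]\<close> and \<open>vector [0, v$1 + v$2]\<close>. Separate \<open>v\<close>
  and \<open>w\<close> cover off-diagonal blocks.\<close>

lemma measure_prepare_form:
  "cinner2 v (measure_prepare A *v w) = cinner2 (vector [v$2, 0]) (A *v vector [w$2, 0])
    + cinner2 (vector [0, v$1 + v$2]) (A *v vector [0, w$1 + w$2])"
  by (simp add: measure_prepare_def cinner2_def matrix_vector_mult_def sum_2 algebra_simps)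

lemma measure_prepare_cp: "completely_positive measure_prepare"
  unfolding completely_positive_def block_psd_def
proof (intro allI impI conjI; elim conjE)
  fix n i j and X :: "nat \<Rightarrow> nat \<Rightarrow> complex^2^2"
  assume "\<forall>i<n. \<forall>j<n. X i j = cadj (X j i)" "i < n" "j < n"
  then have "X i j = cadj (X j i)" by blast
  then show "measure_prepare (X i j) = cadj (measure_prepare (X j i))"
    by (simp add: measure_prepare_def cadj_def vec_eq_iff forall_2)
next
  fix n and X :: "nat \<Rightarrow> nat \<Rightarrow> complex^2^2" and v :: "nat \<Rightarrow> complex^2"
  assume *: "\<forall>v :: nat \<Rightarrow> complex^2. 0 \<le> Re (\<Sum>i<n. \<Sum>j<n. cinner2 (v i) (X i j *v v j))"
  show "0 \<le> Re (\<Sum>i<n. \<Sum>j<n. cinner2 (v i) (measure_prepare (X i j) *v v j))"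
    using *[rule_format, of "\<lambda>i. vector [v i$2, 0]"] *[rule_format, of "\<lambda>i. vector [0, v i$1 + v i$2]"]
    unfolding measure_prepare_form sum.distrib plus_complex.simps by (rule add_nonneg_nonneg)
qed

lemma measure_prepare_parts:
  assumes "herm A"
  defines "B \<equiv> measure_prepare A"
  shows "herm B" "Re (B$1$1) = Re (A$2$2)" "Re (B$2$2) = Re (A$1$1) + Re (A$2$2)"
    "mpol B B = Re (A$1$1) * Re (A$2$2)"
  using assms(1) unfolding mpol_parts
  by (auto simp: B_def herm_iff measure_prepare_def complex_eq_iff algebra_simps power2_eq_square)

lemma measure_prepare_positive: "cone_positive measure_prepare"
  by (auto simp: cone_positive_def psd_iff measure_prepare_parts)

text \<open>The diagonal follows the Fibonacci step from \<open>(a, d)\<close> to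
  \<open>(d, a + d)\<close> and is positive after two steps; the next determinant is the product of
  its entries.\<close>

lemma measure_prepare_strict: "strictly_cone_positive (measure_prepare ^^ 3)"
  unfolding strictly_cone_positive_def
proof (intro allI impI, elim conjE)
  fix A assume A: "psd A" "A \<noteq> 0"
  note p = psdD[OF A(1)]
  let ?B = "(measure_prepare ^^ 3) A"
  have "Re (A$1$1) \<noteq> 0 \<or> Re (A$2$2) \<noteq> 0"
    using A p by (auto simp: mpol_self herm_iff vec_eq_iff forall_2 complex_eq_iff)
  then have "0 < (Re (A$1$1) + Re (A$2$2)) * (Re (A$2$2) + (Re (A$1$1) + Re (A$2$2)))"
    using p by (intro mult_pos_pos) auto
  also have "\<dots> = mpol ?B ?B"
    using p by (simp add: eval_nat_numeral(2,3) measure_prepare_parts)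
  finally show "pd ?B"
    using psd_funpow[OF measure_prepare_positive A(1)] by (intro pd_if_mpol_nonzero) auto
qed

lemma measure_prepare_exponent:
  "cone_primitive measure_prepare" "cone_exponent measure_prepare = 3"
proof -
  \<comment> \<open>The diagonal starts \<open>(1, 0)\<close>, \<open>(0, 1)\<close>, so the first
    two images have determinant zero.\<close>
  let ?A = "vector [vector [1, 0], vector [0, 0]] :: complex^2^2"
  have A: "psd ?A" "?A \<noteq> 0" by (auto simp: psd_iff herm_iff mpol_self vec_eq_iff forall_2)
  have "mpol ((measure_prepare ^^ 2) ?A) ((measure_prepare ^^ 2) ?A) = 0"
    using psdD(1)[OF A(1)] by (simp add: eval_nat_numeral(2,3) measure_prepare_parts)
  then have "\<not> pd ((measure_prepare ^^ 2) ?A)" by (simp add: pd_iff)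
  note * = cone_exponent_eqI[OF clinear_imp_linear[OF measure_prepare_clinear]
      measure_prepare_positive _ A this]
  show "cone_primitive measure_prepare" "cone_exponent measure_prepare = 3"
    using * measure_prepare_strict by (simp_all add: eval_nat_numeral)
qed

section \<open>Vectors in the complex plane and rank-one matrices\<close>

definition cross2 :: "complex^2 \<Rightarrow> complex^2 \<Rightarrow> complex" where
  "cross2 x y = x$1 * y$2 - x$2 * y$1"

text \<open>The conjugates give orthogonality for \<open>cinner2\<close> while keeping the map
  additive in \<open>y\<close>.\<close>

definition perp :: "complex^2 \<Rightarrow> complex^2" where
  "perp y = vector [- cnj (y$2), cnj (y$1)]"

lemma outer_add: "outer (x + y) z = outer x z + outer y z" "outer x (y + z) = outer x y + outer x z"
  by (simp_all add: outer_def vec_eq_iff algebra_simps)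

lemma outer_scale: "outer (c *s x) y = cscale c (outer x y)" "outer x (c *s y) = cscale (cnj c) (outer x y)"
  by (simp_all add: outer_def cscale_def vec_eq_iff algebra_simps)

lemma outer_scale_real: "outer (c *s x) (c *s x) = (cmod c)\<^sup>2 *\<^sub>R outer x x"
  unfolding vec_eq_iff outer_def cmod_power2
  by (simp add: complex_eq_iff algebra_simps power2_eq_square)

lemma cinner2_linear:
  "cinner2 (x + y) z = cinner2 x z + cinner2 y z" "cinner2 x (y + z) = cinner2 x y + cinner2 x z"
  "cinner2 (x - y) z = cinner2 x z - cinner2 y z" "cinner2 x (y - z) = cinner2 x y - cinner2 x z"
  "cinner2 (c *s x) z = cnj c * cinner2 x z" "cinner2 x (c *s z) = c * cinner2 x z"
  by (simp_all add: cinner2_def sum_2 algebra_simps)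

lemma matrix_vector_scale: "(A :: complex^2^2) *v (c *s x) = c *s (A *v x)"
  by (simp add: matrix_vector_mult_def vec_eq_iff sum_2 algebra_simps)

lemma cscale_vector: "cscale c A *v x = c *s (A *v x)"
  by (simp add: cscale_def matrix_vector_mult_def vec_eq_iff sum_2 algebra_simps)

lemma cinner2_outer: "cinner2 u (outer x y *v v) = cinner2 u x * cinner2 y v"
  by (simp add: outer_def cinner2_def matrix_vector_mult_def sum_2 algebra_simps)

lemma cinner2_perp: "cinner2 (perp y) y = 0"
  by (simp add: perp_def cinner2_def sum_2)

lemma perp_independent:
  assumes "cross2 x y \<noteq> 0" "a *s perp x + b *s perp y = 0"
  shows "a = 0 \<and> b = 0"
proof -
  have "a * cnj (x$2) + b * cnj (y$2) = - (a *s perp x + b *s perp y)$1"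
    "a * cnj (x$1) + b * cnj (y$1) = (a *s perp x + b *s perp y)$2"
    by (simp_all add: perp_def)
  then have 1: "a * cnj (x$2) + b * cnj (y$2) = 0" and 2: "a * cnj (x$1) + b * cnj (y$1) = 0"
    unfolding assms(2) by simp_all
  have "a * cnj (cross2 x y) = cnj (y$2) * (a * cnj (x$1) + b * cnj (y$1)) - cnj (y$1) * (a * cnj (x$2) + b * cnj (y$2))"
    "b * cnj (cross2 x y) = cnj (x$1) * (a * cnj (x$2) + b * cnj (y$2)) - cnj (x$2) * (a * cnj (x$1) + b * cnj (y$1))"
    by (simp_all add: cross2_def algebra_simps)
  then have "a * cnj (cross2 x y) = 0 \<and> b * cnj (cross2 x y) = 0" unfolding 1 2 by simp
  with assms(1) show ?thesis by simp
qed

text \<open>Cramer's rule.\<close>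

lemma cross2_decompose:
  assumes "cross2 x y \<noteq> 0"
  shows "z = (cross2 z y / cross2 x y) *s x + (cross2 x z / cross2 x y) *s y"
proof -
  have "cross2 x y * z$i = cross2 z y * x$i + cross2 x z * y$i" for i
    using exhaust_2[of i] by (auto simp: cross2_def algebra_simps)
  with assms show ?thesis by (simp add: vec_eq_iff field_simps)
qed

lemma outer_parallel:
  assumes "cross2 x y = 0" "x \<noteq> 0"
  obtains c where "outer y y = c *\<^sub>R outer x x"
proof -
  have "\<exists>k. y = k *s x"
  proof (cases "x$1 = 0")
    case True
    with assms have "x$2 \<noteq> 0" by (auto simp: vec_eq_iff forall_2)
    with True assms show ?thesis
      by (intro exI[of _ "y$2 / x$2"]) (auto simp: vec_eq_iff forall_2 cross2_def)
  next
    case False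
    with assms show ?thesis
      by (intro exI[of _ "y$1 / x$1"]) (auto simp: vec_eq_iff forall_2 cross2_def field_simps)
  qed
  then obtain k where "y = k *s x" by blast
  with that show thesis by (metis outer_scale_real)
qed

text \<open>The form \<open>F\<close> is the Choi form of \<open>\<Phi>\<close>. The hypotheses put three independent vectors
  \<open>(z\<^sub>0, 0)\<close>, \<open>(0, z\<^sub>1)\<close>, \<open>(z\<^sub>0 + z\<^sub>1, z\<^sub>0 + z\<^sub>1)\<close> with \<open>z\<^sub>i = perp y\<^sub>i\<close> into its kernel, so \<open>F\<close> has rank at
  most one and \<open>\<Phi>\<close> is \<open>A \<mapsto> K A K\<^sup>*\<close> for some \<open>K\<close>; the vector \<open>u\<close> below lies in the kernel of \<open>\<Phi> (x x\<^sup>*)\<close>.\<close>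
lemma cp_three_points:
  assumes clin: "clinear_map \<Phi>" and cp: "completely_positive \<Phi>"
    and x: "cross2 x0 x1 \<noteq> 0" and y: "cross2 y0 y1 \<noteq> 0"
    and im: "\<Phi> (outer x0 x0) = c0 *\<^sub>R outer y0 y0" "\<Phi> (outer x1 x1) = c1 *\<^sub>R outer y1 y1"
      "\<Phi> (outer (x0 + x1) (x0 + x1)) = c2 *\<^sub>R outer (y0 + y1) (y0 + y1)"
  shows "\<not> pd (\<Phi> (outer x x))"
proof -
  have add: "\<Phi> (A + B) = \<Phi> A + \<Phi> B" and scale: "\<Phi> (cscale c A) = cscale c (\<Phi> A)" for A B c
    using clin by (auto simp: clinear_map_def)
  define M where "M = (\<lambda>u v. \<Phi> (outer u v))"
  define G where "G = (\<lambda>u v. cinner2 u (M x0 x0 *v u) + cinner2 u (M x0 x1 *v v)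
      + cinner2 v (M x1 x0 *v u) + cinner2 v (M x1 x1 *v v))"
  define F where "F = (\<lambda>u v. Re (G u v))"
  have F_nonneg: "0 \<le> F u v" for u v
  proof -
    \<comment> \<open>The rank-one block matrix of the stacked vector
      \<open>(x0, x1)\<close>.\<close>
    let ?X = "\<lambda>i j. outer (if i = 0 then x0 else x1) (if j = (0::nat) then x0 else x1)"
    have form: "(\<Sum>i<2. \<Sum>j<2. cinner2 (w i) (?X i j *v w j))
        = (cinner2 (w 0) x0 + cinner2 (w 1) x1) * cnj (cinner2 (w 0) x0 + cinner2 (w 1) x1)" for w :: "nat \<Rightarrow> complex^2"
    proof -
      have "cnj (cinner2 a b) = cinner2 b a" for a b by (simp add: cinner2_def mult.commute)
      then show ?thesis by (simp add: numeral_2_eq_2 cinner2_outer algebra_simps)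
    qed
    have "block_psd 2 ?X"
      unfolding block_psd_def form complex_norm_square[symmetric]
      by (auto simp: outer_def cadj_def vec_eq_iff mult.commute)
    then have "block_psd 2 (\<lambda>i j. \<Phi> (?X i j))" using cp unfolding completely_positive_def by blast
    then have "0 \<le> Re (\<Sum>i<2. \<Sum>j<2. cinner2 ((\<lambda>i::nat. if i = 0 then u else v) i)
        (\<Phi> (?X i j) *v (\<lambda>i::nat. if i = 0 then u else v) j))"
      unfolding block_psd_def by (elim conjE allE)
    then show ?thesis by (simp add: numeral_2_eq_2 F_def G_def M_def algebra_simps)
  qed
  \<comment> \<open>The parallelogram law again: zeros of the nonnegative form \<open>F\<close> are
    closed under addition.\<close>
  have F_add: "F (u + u') (v + v') = 0" if "F u v = 0" "F u' v' = 0" for u u' v v'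
  proof -
    have "F (u + u') (v + v') + F (u - u') (v - v') = 2 * F u v + 2 * F u' v'"
      by (simp add: F_def G_def cinner2_linear algebra_simps)
    with that F_nonneg[of "u + u'" "v + v'"] F_nonneg[of "u - u'" "v - v'"] show ?thesis by simp
  qed
  have F_scale: "F (c *s u) (c *s v) = 0" if "F u v = 0" for c u v
  proof -
    have "G (c *s u) (c *s v) = complex_of_real ((cmod c)\<^sup>2) * G u v"
      unfolding complex_norm_square G_def by (simp add: cinner2_linear matrix_vector_scale algebra_simps)
    with that show ?thesis by (simp add: F_def)
  qed
  \<comment> \<open>This identity carries the three hypotheses into zeros of \<open>F\<close> and
    reads the conclusion back from one.\<close>
  have G_form: "G (cnj a *s u) (cnj b *s u) = cinner2 u (\<Phi> (outer (a *s x0 + b *s x1) (a *s x0 + b *s x1)) *v u)" for a b u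
    by (simp add: G_def M_def outer_add outer_scale add scale cinner2_linear matrix_vector_scale
        cscale_vector algebra_simps)
  have zero: "Re (cinner2 (perp w) ((c *\<^sub>R outer w w) *v perp w)) = 0" for c w
    using linear_cmul[OF linear_cinner2_form[of "perp w"], of c "outer w w"]
    by (simp add: cinner2_outer cinner2_perp)
  define z0 z1 where "z0 = perp y0" and "z1 = perp y1"
  have sum: "perp (y0 + y1) = z0 + z1" by (simp add: z0_def z1_def perp_def vec_eq_iff forall_2)
  have F0: "F z0 0 = 0"
    using G_form[of 1 z0 0] zero[of y0 c0] im(1) by (simp add: F_def z0_def)
  have F1: "F 0 z1 = 0"
    using G_form[of 0 z1 1] zero[of y1 c1] im(2) by (simp add: F_def z1_def)
  have F2: "F (z0 + z1) (z0 + z1) = 0"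
    using G_form[of 1 "z0 + z1" 1] zero[of "y0 + y1" c2] im(3) sum by (simp add: F_def)
  obtain a b where ab: "x = a *s x0 + b *s x1" using cross2_decompose[OF x] by blast
  define \<alpha> \<beta> where "\<alpha> = cnj a" and "\<beta> = cnj b"
  define u where "u = \<alpha> *s z0 + \<beta> *s z1"
  \<comment> \<open>The pair \<open>(\<alpha> u, \<beta> u)\<close> is a combination of the three
    known zeros of \<open>F\<close>.\<close>
  have split: "\<alpha> *s u = (\<alpha> * \<beta>) *s (z0 + z1) + ((\<alpha> * \<alpha> - \<alpha> * \<beta>) *s z0 + (\<beta> * \<beta> - \<alpha> * \<beta>) *s 0)"
    "\<beta> *s u = (\<alpha> * \<beta>) *s (z0 + z1) + ((\<alpha> * \<alpha> - \<alpha> * \<beta>) *s 0 + (\<beta> * \<beta> - \<alpha> * \<beta>) *s z1)"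
    by (simp_all add: u_def vec_eq_iff algebra_simps)
  have "F (\<alpha> *s u) (\<beta> *s u) = 0"
    unfolding split by (intro F_add F_scale F0 F1 F2)
  then have form0: "Re (cinner2 u (\<Phi> (outer x x) *v u)) = 0"
    using G_form[of a u b] by (simp add: F_def ab \<alpha>_def \<beta>_def)
  show ?thesis
  proof (cases "u = 0")
    case True
    then have "\<alpha> = 0 \<and> \<beta> = 0" using perp_independent[OF y] by (simp add: u_def z0_def z1_def)
    then have "x = 0" by (simp add: ab \<alpha>_def \<beta>_def)
    then have "outer x x = 0" by (simp add: outer_def vec_eq_iff)
    then show ?thesis using linear_0[OF clinear_imp_linear[OF clin]] not_pd_0 by simp
  next
    case False
    with form0 show ?thesis by (auto simp: pd_def)
  qed
qed

text \<open>Proportionality recurs with period \<open>j - i\<close>, so a singular iterate would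
  have singular multiples arbitrarily late in the orbit.\<close>

lemma primitive_not_eventually_proportional:
  assumes lin: "linear \<Phi>" and prim: "cone_primitive \<Phi>" and A: "psd A" "A \<noteq> 0"
    and "i < j" and eq: "(\<Phi> ^^ j) A = c *\<^sub>R (\<Phi> ^^ i) A"
  shows "pd ((\<Phi> ^^ i) A)"
proof (rule ccontr)
  let ?B = "(\<Phi> ^^ i) A"
  assume "\<not> pd ?B"
  then have B: "mpol ?B ?B = 0"
    using primitive_orbit[OF lin prim A] by (intro psd_not_pd_mpol) auto
  define d where "d = j - i"
  have lin_d: "linear (\<Phi> ^^ d)"
    by (induction d) (simp_all only: funpow.simps linear_id linear_compose[OF _ lin])
  have "(\<Phi> ^^ d) ?B = c *\<^sub>R ?B"
    using eq \<open>i < j\<close> by (simp add: d_def flip: funpow_add[THEN fun_cong, unfolded o_apply])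
  then have "\<exists>s. (\<Phi> ^^ (d * n + i)) A = s *\<^sub>R ?B" for n
  proof (induction n)
    case 0 show ?case by (auto intro: exI[of _ 1])
  next
    case (Suc n)
    then obtain s where "(\<Phi> ^^ (d * n + i)) A = s *\<^sub>R ?B" by blast
    then have "(\<Phi> ^^ d) ((\<Phi> ^^ (d * n + i)) A) = (s * c) *\<^sub>R ?B"
      by (simp add: linear_cmul[OF lin_d] Suc.prems)
    then show ?case by (auto simp: funpow_add add_ac)
  qed
  moreover obtain k where k: "\<And>i. k \<le> i \<Longrightarrow> pd ((\<Phi> ^^ i) A)"
    using primitive_not_always_singular[OF lin prim A] by blast
  ultimately obtain s where "(\<Phi> ^^ (d * k + i)) A = s *\<^sub>R ?B" by blast
  moreover have "k \<le> d * k + i" 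
    using mult_le_mono1[of 1 d k] \<open>i < j\<close> unfolding d_def by linarith
  ultimately have "pd (s *\<^sub>R ?B)" using k by metis
  then show False
    using B by (simp add: pd_iff bilinear_lmul[OF bilinear_mpol] bilinear_rmul[OF bilinear_mpol])
qed

lemma primitive_cp_strictly_positive_3:
  assumes clin: "clinear_map \<Phi>" and cp: "completely_positive \<Phi>" and prim: "cone_primitive \<Phi>"
  shows "strictly_cone_positive (\<Phi> ^^ 3)"
  unfolding strictly_cone_positive_def
proof (intro allI impI, elim conjE, rule ccontr)
  fix A assume A: "psd A" "A \<noteq> 0" and bad: "\<not> pd ((\<Phi> ^^ 3) A)"
  have lin: "linear \<Phi>" using clin by (rule clinear_imp_linear)
  have pos: "cone_positive \<Phi>" using prim by (simp add: cone_primitive_def)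
  note orbit = primitive_orbit[OF lin prim A bad]
  have "\<exists>x. i \<le> 3 \<longrightarrow> (\<Phi> ^^ i) A = outer x x" for i
    using orbit(1,2) psd_not_pd_outer by metis
  then obtain x where x: "\<And>i. i \<le> 3 \<Longrightarrow> (\<Phi> ^^ i) A = outer (x i) (x i)" by metis
  have cross: "cross2 (x i) (x j) \<noteq> 0" if "i < j" "j \<le> 3" for i j
  proof
    assume "cross2 (x i) (x j) = 0"
    moreover have "x i \<noteq> 0" using x[of i] orbit(3)[of i] that by (auto simp: outer_def vec_eq_iff)
    ultimately obtain c where "outer (x j) (x j) = c *\<^sub>R outer (x i) (x i)" using outer_parallel by blast
    then have "pd ((\<Phi> ^^ i) A)"
      using that x by (intro primitive_not_eventually_proportional[OF lin prim A that(1)]) auto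
    with orbit(2)[of i] that show False by simp
  qed
  have cross': "cross2 (x j) (x i) \<noteq> 0" if "i < j" "j \<le> 3" for i j
    using cross[OF that] by (auto simp: cross2_def algebra_simps)
  \<comment> \<open>Both Cramer coefficients are nonzero because the three directions are pairwise
    independent.\<close>
  have dec: "\<exists>a b. a \<noteq> 0 \<and> b \<noteq> 0 \<and> x (i + 2) = a *s x i + b *s x (i + 1)" if "i \<le> 1" for i
    using cross2_decompose[of "x i" "x (i + 1)" "x (i + 2)"] cross[of i "i + 1"] cross[of i "i + 2"]
      cross'[of "i + 1" "i + 2"] that by (intro exI conjI) auto
  obtain a b where ab: "a \<noteq> 0" "b \<noteq> 0" "x 2 = a *s x 0 + b *s x 1" using dec[of 0] by (auto simp: numeral_2_eq_2)
  obtain c d where cd: "c \<noteq> 0" "d \<noteq> 0" "x 3 = c *s x 1 + d *s x 2"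
    using dec[of 1] by (auto simp: numeral_2_eq_2 numeral_3_eq_3)
  have step: "\<Phi> (outer (x i) (x i)) = outer (x (Suc i)) (x (Suc i))" if "i \<le> 2" for i
    using x[of i] x[of "Suc i"] that by simp
  have step': "\<exists>r. \<Phi> (outer (e *s x i) (e *s x i)) = r *\<^sub>R outer (f *s x (Suc i)) (f *s x (Suc i))"
    if "i \<le> 2" "f \<noteq> 0" for e f i
    using that
    by (intro exI[of _ "(cmod e)\<^sup>2 / (cmod f)\<^sup>2"]) (simp add: outer_scale_real linear_cmul[OF lin] step)
  \<comment> \<open>Scaling by \<open>a\<close>, \<open>b\<close> in the source and by
    \<open>c\<close>, \<open>d\<close> in the target makes the third direction a sum on both sides,
    as \<open>cp_three_points\<close> demands.\<close>
  obtain r0 where r0: "\<Phi> (outer (a *s x 0) (a *s x 0)) = r0 *\<^sub>R outer (c *s x 1) (c *s x 1)"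
    using step'[of 0 c a] cd by auto
  obtain r1 where r1: "\<Phi> (outer (b *s x 1) (b *s x 1)) = r1 *\<^sub>R outer (d *s x 2) (d *s x 2)"
    using step'[of 1 d b] cd by (auto simp: numeral_2_eq_2)
  have r2: "\<Phi> (outer (a *s x 0 + b *s x 1) (a *s x 0 + b *s x 1))
      = 1 *\<^sub>R outer (c *s x 1 + d *s x 2) (c *s x 1 + d *s x 2)"
    using step[of 2] ab cd by (simp add: numeral_2_eq_2 numeral_3_eq_3)
  have "cross2 (a *s x 0) (b *s x 1) = a * b * cross2 (x 0) (x 1)"
    "cross2 (c *s x 1) (d *s x 2) = c * d * cross2 (x 1) (x 2)"
    by (simp_all add: cross2_def algebra_simps)
  then have sing: "\<not> pd (\<Phi> (outer w w))" for w
    using ab cd cross[of 0 1] cross[of 1 2] by (intro cp_three_points[OF clin cp _ _ r0 r1 r2]) auto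
  \<comment> \<open>A singular iterate is some \<open>outer w w\<close>, so \<open>sing\<close>
    propagates singularity forever.\<close>
  have "\<not> pd ((\<Phi> ^^ i) A)" for i
  proof (induction i)
    case 0 show ?case using orbit(2)[of 0] by simp
  next
    case (Suc i)
    with psd_funpow[OF pos A(1)] obtain w where "(\<Phi> ^^ i) A = outer w w" using psd_not_pd_outer by blast
    with sing show ?case by simp
  qed
  then show False using primitive_not_always_singular[OF lin prim A] by blast
qed

theorem max_exponent_cp_eq: "max_exponent_cp = 3"
  unfolding max_exponent_cp_def
proof (intro antisym Sup_least Sup_upper)
  fix e assume "e \<in> {enat (cone_exponent \<Phi>) |\<Phi>. clinear_map \<Phi> \<and> completely_positive \<Phi> \<and> cone_primitive \<Phi>}"
  then show "e \<le> 3"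
    by (auto simp: numeral_eq_enat intro!: cone_exponent_le primitive_cp_strictly_positive_3)
next
  show "3 \<in> {enat (cone_exponent \<Phi>) |\<Phi>. clinear_map \<Phi> \<and> completely_positive \<Phi> \<and> cone_primitive \<Phi>}"
    using measure_prepare_exponent measure_prepare_clinear measure_prepare_cp
    by (auto simp: numeral_eq_enat intro!: exI[of _ measure_prepare])
qed

theorem theorem10:
  shows "max_exponent = 4 \<and> max_exponent_cp = 3"
  using max_exponent_eq max_exponent_cp_eq by simp

end
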